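(* Let $d\ge 1$, $\alpha>0$, $\beta\ge 0$, $\eta\in(0,1)$, let $F\in\mathbb{R}^{d\times d}$ be symmetric positive semidefinite with orthonormal eigenbasis $v_0,\dots,v_{d-1}$, $Fv_i=\lambda_i v_i$, $\lambda_i\ge 0$, and let $\lambda_{\max}=\max_i\lambda_i$. Let $g\in\mathbb{R}^d$, and let the lag vectors $\delta_s\in\mathbb{R}^d$ satisfy $\delta_{s+1}=(\eta I-\alpha\beta F)\delta_s+\alpha g$ for all $s\ge t$. Put $\delta_s^{(i)}=\delta_s^\top v_i$, $g^{(i)}=g^\top v_i$ and $\chi_i=\eta-\alpha\beta\lambda_i$. Then for every $k\ge 1$ and every $i$, $$\delta_{t+k}^{(i)}=(\chi_i)^k\,\delta_t^{(i)}+\alpha\,\frac{1-(\chi_i)^k}{1-\chi_i}\,g^{(i)} .$$ Consequently the lag dynamics is stable if and only if $$\alpha\beta\lambda_{\max}<1+\eta .$$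
   Context: Setting: parameters $\theta_t$ are updated by policy gradient with a KL penalty towards an exponential-moving-average (EMA) anchor $\theta_{\mathrm{ema},t}$, where the KL is replaced by its local quadratic approximation with Fisher matrix $F$ and the gradient $g$ and matrix $F$ are frozen: $\theta_{t+1}=\theta_t+\alpha g-\alpha\beta F\delta_t$, $\theta_{\mathrm{ema},t+1}=\eta\theta_{\mathrm{ema},t}+(1-\eta)\theta_t$, with lag $\delta_t=\theta_t-\theta_{\mathrm{ema},t}$. This yields the lag recursion in the claim. "Stable" means that the transient part of the dynamics vanishes for every initial lag, i.e. $(\chi_i)^k\delta_t^{(i)}\to 0$ as $k\to\infty$ for all $i$ and all $\delta_t\in\mathbb{R}^d$; equivalently $\max_i|\chi_i|<1$. *)

theory Defs
  imports "HOL-Analysis.Analysis"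
begin

definition pos_semidef :: "real ^ 'n ^ 'n \<Rightarrow> bool" where
  "pos_semidef F \<longleftrightarrow> transpose F = F \<and> (\<forall>x. 0 \<le> x \<bullet> (F *v x))"

(* Only the vectors v 0, ..., v (d - 1) matter, where d = CARD('n).
   Being d orthonormal vectors of a d-dimensional space, they form a basis. *)
definition orthonormal_eigenbasis ::
    "real ^ 'n ^ 'n \<Rightarrow> (nat \<Rightarrow> real ^ 'n) \<Rightarrow> (nat \<Rightarrow> real) \<Rightarrow> bool" where
  "orthonormal_eigenbasis F v lam \<longleftrightarrow>
     (\<forall>i<CARD('n). \<forall>j<CARD('n). v i \<bullet> v j = (if i = j then 1 else 0)) \<and>
     (\<forall>i<CARD('n). F *v v i = lam i *\<^sub>R v i)"

definition lag_factor :: "real \<Rightarrow> real \<Rightarrow> real \<Rightarrow> real \<Rightarrow> real" where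
  "lag_factor \<alpha> \<beta> \<eta> l = \<eta> - \<alpha> * \<beta> * l"

(* The transient part of every eigencoordinate vanishes for every initial lag x;
   x ranges over the whole space, independently of any particular trajectory. *)
definition lag_stable ::
    "real \<Rightarrow> real \<Rightarrow> real \<Rightarrow> (nat \<Rightarrow> real ^ 'n) \<Rightarrow> (nat \<Rightarrow> real) \<Rightarrow> bool" where
  "lag_stable \<alpha> \<beta> \<eta> v lam \<longleftrightarrow>
     (\<forall>x :: real ^ 'n. \<forall>i<CARD('n).
        (\<lambda>k. lag_factor \<alpha> \<beta> \<eta> (lam i) ^ k * (x \<bullet> v i)) \<longlonglongrightarrow> 0)"

end

theory Submission
  imports Defs
begin

text \<open>
  Pairing the recursion with an eigenvector of the symmetric matrix decouples it into scalar
  affine recursions with factors \<open>\<chi>\<^sub>i\<close>. Since \<open>\<chi>\<^sub>i \<le> \<eta> < 1\<close> always holds, the divisor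
  \<open>1 - \<chi>\<^sub>i\<close> is nonzero and \<open>\<bar>\<chi>\<^sub>i\<bar> < 1\<close> reduces to \<open>\<chi>\<^sub>i > -1\<close>,
  which is most restrictive for the largest eigenvalue.
\<close>

text \<open>If \<open>1 \<le> \<bar>c\<bar>\<close>, every power has absolute value at least 1, a
  bound that would survive in the limit and contradict convergence to 0.\<close>

lemma realpow_tendsto_zero_iff:
  fixes c :: real
  shows "(\<lambda>k. c ^ k) \<longlonglongrightarrow> 0 \<longleftrightarrow> \<bar>c\<bar> < 1"
proof
  assume lim: "(\<lambda>k. c ^ k) \<longlonglongrightarrow> 0"
  show "\<bar>c\<bar> < 1"
  proof (rule ccontr)
    assume "\<not> \<bar>c\<bar> < 1"
    then have ge: "1 \<le> \<bar>c ^ k\<bar>" for k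
      by (simp add: power_abs one_le_power)
    have "(\<lambda>k. \<bar>c ^ k\<bar>) \<longlonglongrightarrow> 0"
      using tendsto_rabs_zero[OF lim] .
    then have "(1::real) \<le> 0"
      by (rule LIMSEQ_le_const) (use ge in blast)
    then show False by simp
  qed
qed (rule LIMSEQ_power_zero, simp)

text \<open>Symmetry moves \<open>F\<close> across the inner product onto its eigenvector, so each
  eigencoordinate evolves without reference to the others.\<close>

lemma matrix_vector_mult_inner_eigenvector:
  fixes F :: "real ^ 'n ^ 'n"
  assumes "transpose F = F" and "F *v u = l *\<^sub>R u"
  shows "(F *v x) \<bullet> u = l * (x \<bullet> u)"
proof -
  have "(F *v x) \<bullet> u = x \<bullet> (F *v u)"
    using transpose_matrix_vector[of F x] assms(1) by (simp add: dot_lmul_matrix)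
  then show ?thesis using assms(2) by simp
qed

text \<open>The coefficient of \<open>b\<close> is the geometric sum of the first \<open>k\<close>
  powers of \<open>c\<close>; \<open>c \<noteq> 1\<close> makes its quotient form a genuine
  division.\<close>

lemma affine_recursion_closed_form:
  fixes y :: "nat \<Rightarrow> 'a :: field"
  assumes "\<And>k. y (Suc k) = c * y k + b" and "c \<noteq> 1"
  shows "y k = c ^ k * y 0 + b * ((1 - c ^ k) / (1 - c))"
proof (induction k)
  case (Suc k)
  have "1 - c \<noteq> 0" using assms(2) by simp
  then show ?case
    unfolding assms(1) Suc by (simp add: field_simps)
qed simp

text \<open>Taking \<open>v i\<close> itself as initial lag gives an i-th coordinate equal to 1,
  which leaves the bare powers of the factor. Conversely, a coordinate is constant in
  \<open>k\<close> and merely scales a null sequence.\<close>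

lemma lag_stable_iff:
  fixes F :: "real ^ 'n ^ 'n"
  assumes "orthonormal_eigenbasis F v lam"
  shows "lag_stable \<alpha> \<beta> \<eta> v lam \<longleftrightarrow>
    (\<forall>i<CARD('n). \<bar>lag_factor \<alpha> \<beta> \<eta> (lam i)\<bar> < 1)"
proof (intro iffI allI impI)
  fix i assume "lag_stable \<alpha> \<beta> \<eta> v lam" and i: "i < CARD('n)"
  then have "(\<lambda>k. lag_factor \<alpha> \<beta> \<eta> (lam i) ^ k * (v i \<bullet> v i)) \<longlonglongrightarrow> 0"
    unfolding lag_stable_def by blast
  moreover have "v i \<bullet> v i = 1"
    using assms i unfolding orthonormal_eigenbasis_def by simp
  ultimately show "\<bar>lag_factor \<alpha> \<beta> \<eta> (lam i)\<bar> < 1"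
    by (simp add: realpow_tendsto_zero_iff)
next
  assume "\<forall>i<CARD('n). \<bar>lag_factor \<alpha> \<beta> \<eta> (lam i)\<bar> < 1"
  then show "lag_stable \<alpha> \<beta> \<eta> v lam"
    unfolding lag_stable_def
    by (blast intro: tendsto_mult_left_zero realpow_tendsto_zero_iff[THEN iffD2])
qed

theorem lemma4p2:
  fixes F :: "real ^ 'n ^ 'n"
    and v :: "nat \<Rightarrow> real ^ 'n"
    and lam :: "nat \<Rightarrow> real"
    and \<alpha> \<beta> \<eta> lam_max :: real
    and g :: "real ^ 'n"
    and \<delta> :: "nat \<Rightarrow> real ^ 'n"
    and t :: nat
  assumes "\<alpha> > 0" and "\<beta> \<ge> 0" and "0 < \<eta>" and "\<eta> < 1"
    and "pos_semidef F"
    and "orthonormal_eigenbasis F v lam"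
    and "\<And>i. i < CARD('n) \<Longrightarrow> lam i \<ge> 0"
    and "lam_max = Max (lam ` {..<CARD('n)})"
    and "\<And>s. s \<ge> t \<Longrightarrow>
           \<delta> (Suc s) = (\<eta> *\<^sub>R mat 1 - (\<alpha> * \<beta>) *\<^sub>R F) *v \<delta> s + \<alpha> *\<^sub>R g"
  shows "(\<forall>k\<ge>1. \<forall>i<CARD('n).
            \<delta> (t + k) \<bullet> v i =
              lag_factor \<alpha> \<beta> \<eta> (lam i) ^ k * (\<delta> t \<bullet> v i)
              + \<alpha> * ((1 - lag_factor \<alpha> \<beta> \<eta> (lam i) ^ k) / (1 - lag_factor \<alpha> \<beta> \<eta> (lam i)))
                * (g \<bullet> v i))
         \<and> (lag_stable \<alpha> \<beta> \<eta> v lam \<longleftrightarrow> \<alpha> * \<beta> * lam_max < 1 + \<eta>)"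
proof (intro conjI allI impI)
  have factor_less_1: "lag_factor \<alpha> \<beta> \<eta> (lam i) < 1" if "i < CARD('n)" for i
  proof -
    have "0 \<le> \<alpha> * \<beta> * lam i" using assms(1,2,7) that by simp
    then show ?thesis using assms(4) by (simp add: lag_factor_def)
  qed
  {
    fix k i :: nat
    assume i: "i < CARD('n)"
    let ?c = "lag_factor \<alpha> \<beta> \<eta> (lam i)"
    have F_inner: "(F *v x) \<bullet> v i = lam i * (x \<bullet> v i)" for x
      using assms(5,6) i
      by (intro matrix_vector_mult_inner_eigenvector)
        (simp_all add: pos_semidef_def orthonormal_eigenbasis_def)
    have "\<delta> (t + Suc m) \<bullet> v i = ?c * (\<delta> (t + m) \<bullet> v i) + \<alpha> * (g \<bullet> v i)" for m
    proof -
      have "\<delta> (t + Suc m) \<bullet> v i =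
          ((\<eta> *\<^sub>R mat 1 - (\<alpha> * \<beta>) *\<^sub>R F) *v \<delta> (t + m) + \<alpha> *\<^sub>R g) \<bullet> v i"
        using assms(9)[of "t + m"] by simp
      then show ?thesis
        by (simp add: matrix_vector_mult_diff_rdistrib scaleR_matrix_vector_assoc[symmetric]
            inner_simps F_inner lag_factor_def left_diff_distrib)
    qed
    \<comment> \<open>Time is counted from \<open>t\<close>, so the value at index 0 is the
      coordinate of \<open>\<delta> t\<close>.\<close>
    from affine_recursion_closed_form[of "\<lambda>m. \<delta> (t + m) \<bullet> v i", OF this]
    show "\<delta> (t + k) \<bullet> v i =
        ?c ^ k * (\<delta> t \<bullet> v i) + \<alpha> * ((1 - ?c ^ k) / (1 - ?c)) * (g \<bullet> v i)"
      using factor_less_1[OF i] by (simp add: mult_ac)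
  }
  \<comment> \<open>The upper half of the absolute value bound is \<open>factor_less_1\<close>; the
    lower half, factor above -1, rearranges to the displayed inequality.\<close>
  have "lag_stable \<alpha> \<beta> \<eta> v lam \<longleftrightarrow> (\<forall>i<CARD('n). \<alpha> * \<beta> * lam i < 1 + \<eta>)"
    unfolding lag_stable_iff[OF assms(6)]
    using factor_less_1 by (fastforce simp: lag_factor_def abs_less_iff)
  also have "\<dots> \<longleftrightarrow> \<alpha> * \<beta> * lam_max < 1 + \<eta>"
  proof -
    have ne: "lam ` {..<CARD('n)} \<noteq> {}" by (simp add: lessThan_empty_iff)
    \<comment> \<open>The maximum is attained, so the condition at \<open>j\<close> is the one on
      \<open>lam_max\<close>; since \<open>\<alpha> * \<beta> \<ge> 0\<close>, it implies the
      condition at every other index.\<close>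
    obtain j where j: "j < CARD('n)" "lam_max = lam j"
      using Max_in[OF _ ne] assms(8) by auto
    have "\<alpha> * \<beta> * lam i \<le> \<alpha> * \<beta> * lam_max" if "i < CARD('n)" for i
      using that assms(1,2,8) by (intro mult_left_mono) auto
    then show ?thesis using j by (meson le_less_trans)
  qed
  finally show "lag_stable \<alpha> \<beta> \<eta> v lam \<longleftrightarrow> \<alpha> * \<beta> * lam_max < 1 + \<eta>" .
qed

end
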